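(* Let $A\in\mathbb{R}^{m\times d}$ and $b\in\mathbb{R}^m$, let $Av=b$ be a linear system and let the sequence $(v^k)_k$ be generated by the SGDAS iteration (described in the context) with constant stepsize $\tau_k=\tau$, $$0<\tau<\frac{2}{c\|A\|^2},$$ where the random directions $x$ are sampled according to the isotropy assumption with constant $c$. Then it holds for the expectation taken with respect to the random choice of $x$ in the $k$th step that $$\mathbb{E}\big(\|Av^{k+1}-b\|^2\big)\le\beta\,\|Av^k-b\|^2\qquad\text{with}\qquad \beta:=1-\tau\,\sigma_{\min}(A)^2\left(2-\tau c\|A\|^2\right).$$ If $\sigma_{\min}(A)>0$, we have $0<\beta<1$ and hence we have linear convergence $$\mathbb{E}\big(\|Av^{k+1}-b\|^2\big)\le\beta^{k+1}\|Av^0-b\|^2 .$$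
   Context: $\|\cdot\|$ is the Euclidean norm for vectors and the corresponding operator (spectral) norm for matrices; $\sigma_{\min}(A)$ is the smallest positive singular value of $A$. Isotropy assumption on the random direction $x\in\mathbb{R}^d$: $\mathbb{E}(xx^T)=I_d$ and $\mathbb{E}(xx^T\|x\|^2)=c\,I_d$ for some constant $c$. SGDAS (stochastic gradient descent with adjoint sampling): $v^0=0\in\mathbb{R}^d$ and, for $k=0,1,2,\dots$, draw a fresh random vector $x$ and set $v^{k+1}=v^k-\tau_k\langle Av^k-b,Ax\rangle x$. In the last inequality $\mathbb{E}$ is the expectation over all involved randomness.
   Formalization: The system Av=b is assumed consistent (otherwise the inequality fails, e.g. A=(1,0)^T, b=(0,1)^T), and β>0 is claimed except when d=1, c=1 and τ‖A‖²=1, where β=0; there 0≤β<1 and the convergence bound still hold. *)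

theory Defs
  imports "HOL-Analysis.Analysis" "HOL-Probability.Probability"
begin

abbreviation opnorm :: "real^'d^'m \<Rightarrow> real" where
  "opnorm A \<equiv> onorm ((*v) A)"

definition singular_value :: "real^'d^'m \<Rightarrow> real \<Rightarrow> bool" where
  "singular_value A s \<longleftrightarrow>
     s \<ge> 0 \<and> (\<exists>v. v \<noteq> 0 \<and> (transpose A ** A) *v v = s\<^sup>2 *\<^sub>R v)"

text \<open>The zero matrix has no positive singular value; there we use the value 0, so that
  \<open>sigma_min A > 0\<close> is a genuine condition.\<close>

definition sigma_min :: "real^'d^'m \<Rightarrow> real" where
  "sigma_min A = (if A = 0 then 0 else (LEAST s. s > 0 \<and> singular_value A s))"

definition outer :: "real^'d \<Rightarrow> real^'d \<Rightarrow> real^'d^'d" where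
  "outer x y = (\<chi> i j. x $ i * y $ j)"

definition isotropic :: "'a measure \<Rightarrow> ('a \<Rightarrow> real^'d) \<Rightarrow> real \<Rightarrow> bool" where
  "isotropic M x c \<longleftrightarrow>
     has_bochner_integral M (\<lambda>\<omega>. outer (x \<omega>) (x \<omega>)) (mat 1) \<and>
     has_bochner_integral M (\<lambda>\<omega>. (norm (x \<omega>))\<^sup>2 *\<^sub>R outer (x \<omega>) (x \<omega>)) (c *\<^sub>R mat 1)"

text \<open>The iteration along one realisation \<open>x 0, x 1, \<dots>\<close> of the random directions;
  \<open>sgdas A b \<tau> x k\<close> depends on \<open>x j\<close> for \<open>j < k\<close> only.\<close>

primrec sgdas ::
  "real^'d^'m \<Rightarrow> real^'m \<Rightarrow> (nat \<Rightarrow> real) \<Rightarrow> (nat \<Rightarrow> real^'d) \<Rightarrow> nat \<Rightarrow> real^'d" where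
  "sgdas A b \<tau> x 0 = 0"
| "sgdas A b \<tau> x (Suc k) =
     sgdas A b \<tau> x k
       - (\<tau> k * ((A *v sgdas A b \<tau> x k - b) \<bullet> (A *v x k))) *\<^sub>R x k"

end

theory Submission
  imports Defs
begin

text \<open>
  Write \<open>r = A v - b\<close> for the residual and \<open>g = A\<^sup>T r\<close>. One step with direction \<open>x\<close> replaces
  \<open>r\<close> by \<open>r - \<tau> \<langle>g, x\<rangle> A x\<close>, so its squared norm becomes
  \<open>\<parallel>r\<parallel>\<^sup>2 - 2 \<tau> \<langle>g, x\<rangle>\<^sup>2 + \<tau>\<^sup>2 \<langle>g, x\<rangle>\<^sup>2 \<parallel>A x\<parallel>\<^sup>2\<close>. The isotropy assumption turns the
  mean of \<open>\<langle>g, x\<rangle>\<^sup>2\<close> into \<open>\<parallel>g\<parallel>\<^sup>2\<close>, and after \<open>\<parallel>A x\<parallel> \<le> \<parallel>A\<parallel> \<parallel>x\<parallel>\<close> it bounds the mean of the last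
  term by \<open>\<tau>\<^sup>2 c \<parallel>A\<parallel>\<^sup>2 \<parallel>g\<parallel>\<^sup>2\<close>. Hence the expected decrease is at least
  \<open>\<tau> (2 - \<tau> c \<parallel>A\<parallel>\<^sup>2) \<parallel>g\<parallel>\<^sup>2\<close>. As the system is consistent, \<open>r\<close> lies in the range of \<open>A\<close>, where
  \<open>\<parallel>A\<^sup>T r\<parallel> \<ge> \<sigma>\<^sub>m\<^sub>i\<^sub>n \<parallel>r\<parallel>\<close> (\<open>sigma_min_transpose_lower_bound\<close>); this gives the factor \<open>\<beta>\<close>
  (\<open>expected_residual_sgdas_step\<close>).

  The bound by \<open>\<sigma>\<^sub>m\<^sub>i\<^sub>n\<close> is variational. The minimum of \<open>\<parallel>A v\<parallel>\<close> over
  the unit sphere of the range of \<open>A\<^sup>T\<close>, the orthogonal complement of the kernel, is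
  attained; the first-order condition makes the minimiser an eigenvector of \<open>A\<^sup>T A\<close>
  (\<open>least_stretch_on_range_transpose\<close>), and all eigenvectors for other positive singular values
  lie in the same subspace, so the minimum is \<open>\<sigma>\<^sub>m\<^sub>i\<^sub>n\<close> (\<open>sigma_min_eqI\<close>).

  Nonnegativity of \<open>\<beta>\<close> comes from \<open>c \<ge> d\<close> (\<open>isotropic_constant_ge_dim\<close>): with
  \<open>t = \<tau> \<parallel>A\<parallel>\<^sup>2\<close> and \<open>\<sigma>\<^sub>m\<^sub>i\<^sub>n \<le> \<parallel>A\<parallel>\<close> one gets \<open>\<beta> \<ge> (1 - t)\<^sup>2 + (c - 1) t\<^sup>2\<close>, which vanishes only
  for \<open>t = 1\<close> and \<open>c = 1\<close>, and then \<open>d = 1\<close>. Finally, the \<open>k\<close>-th iterate is independent of the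
  \<open>k\<close>-th direction, so the inequality for a fixed iterate can be integrated over the
  iterate by Fubini, and induction on \<open>k\<close> gives the linear rate.
\<close>

section \<open>The smallest positive singular value\<close>

declare transpose_matrix_vector [simp del]

lemma inner_transpose_matrix:
  fixes A :: "real^'d^'m"
  shows "(transpose A *v y) \<bullet> x = y \<bullet> (A *v x)"
  by (metis dot_lmul_matrix transpose_matrix_vector)

lemma norm_matrix_le_opnorm:
  fixes A :: "real^'d^'m"
  shows "norm (A *v x) \<le> opnorm A * norm x"
  by (rule onorm) (rule matrix_vector_mul_bounded_linear)

lemma opnorm_zero: "opnorm (0 :: real^'d^'m) = 0"
  by (simp add: onorm_def)

text \<open>The component of \<open>u\<close> orthogonal to the range of \<open>A\<^sup>T\<close> lies in the kernel of \<open>A\<close>, so dropping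
  it does not change the image.\<close>

lemma preimage_in_range_transpose:
  fixes A :: "real^'d^'m"
  obtains v where "v \<in> range ((*v) (transpose A))" "A *v v = A *v u"
proof -
  let ?S = "range ((*v) (transpose A))"
  have S: "subspace ?S"
    by (intro linear_subspace_image matrix_vector_mul_linear subspace_UNIV)
  obtain y z where y: "y \<in> span ?S" and z: "\<And>w. w \<in> span ?S \<Longrightarrow> orthogonal z w" and u: "u = y + z"
    using orthogonal_subspace_decomp_exists[of ?S u] by metis
  have "orthogonal z (transpose A *v (A *v z))"
    by (intro z span_base) auto
  then have "A *v z = 0"
    by (metis inner_eq_zero_iff inner_transpose_matrix inner_commute orthogonal_def)
  with u have "A *v y = A *v u"
    by (simp add: matrix_vector_right_distrib)
  moreover from y S have "y \<in> ?S"
    by (simp add: span_eq_iff[THEN iffD2])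
  ultimately show thesis using that by blast
qed

text \<open>The first-order condition at a minimum, in the form needed for the minimiser below.\<close>

lemma nonneg_quadratic_linear_term_zero:
  fixes p q :: real
  assumes "\<And>t. 0 \<le> 2 * t * p + t\<^sup>2 * q" "0 \<le> q"
  shows "p = 0"
proof -
  \<comment> \<open>The minimiser \<open>- p / q\<close> of the quadratic would do, but \<open>q\<close> may vanish.\<close>
  define t where "t = - p / (q + 1)"
  have p: "p = - (t * (q + 1))"
    using assms(2) by (simp add: t_def)
  have "0 \<le> 2 * t * p + t\<^sup>2 * q" by (rule assms)
  also have "\<dots> = - (t\<^sup>2 * (q + 2))"
    by (simp add: p algebra_simps power2_eq_square)
  finally have "t = 0"
    using assms(2) by (simp add: mult_le_0_iff)
  with p show ?thesis by simp
qed

text \<open>The minimiser \<open>v\<close> of \<open>\<parallel>A v\<parallel>\<close> on the unit sphere of the range of \<open>A\<^sup>T\<close> is a right singular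
  vector: \<open>q w = \<parallel>A w\<parallel>\<^sup>2 - s\<^sup>2 \<parallel>w\<parallel>\<^sup>2\<close> is nonnegative on this subspace and zero at \<open>v\<close>, so its
  derivative at \<open>v\<close> vanishes along the subspace. Half its gradient there,
  \<open>g = A\<^sup>T A v - s\<^sup>2 v\<close>, is itself in the subspace, hence zero. The minimum is positive because
  the range of \<open>A\<^sup>T\<close> meets the kernel of \<open>A\<close> only in \<open>0\<close>.\<close>

lemma least_stretch_on_range_transpose:
  fixes A :: "real^'d^'m"
  assumes "A \<noteq> 0"
  obtains v s where "s > 0" "norm v = 1" "norm (A *v v) = s"
    "(transpose A ** A) *v v = s\<^sup>2 *\<^sub>R v"
    "\<And>w. w \<in> range ((*v) (transpose A)) \<Longrightarrow> s * norm w \<le> norm (A *v w)"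
proof -
  let ?S = "range ((*v) (transpose A))"
  let ?K = "?S \<inter> sphere 0 1"
  have S: "subspace ?S"
    by (intro linear_subspace_image matrix_vector_mul_linear subspace_UNIV)
  obtain u where u: "A *v u \<noteq> 0"
    using assms by (metis matrix_eq matrix_vector_mult_0)
  then obtain v1 where v1: "v1 \<in> ?S" "A *v v1 = A *v u"
    using preimage_in_range_transpose[of A u] by blast
  with u have "v1 \<noteq> 0" by auto
  with v1 S have "(1 / norm v1) *\<^sub>R v1 \<in> ?K"
    by (auto intro: subspace_scale)
  then have "?K \<noteq> {}" by blast
  moreover have "compact ?K"
    using closed_subspace[OF S] compact_sphere by (metis closed_Int_compact)
  moreover have "continuous_on ?K (\<lambda>v. norm (A *v v))"
    by (intro continuous_on_norm linear_continuous_on matrix_vector_mul_bounded_linear)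
  ultimately obtain v where v: "v \<in> ?K"
      and vmin: "\<And>w. w \<in> ?K \<Longrightarrow> norm (A *v v) \<le> norm (A *v w)"
    using continuous_attains_inf[of ?K "\<lambda>v. norm (A *v v)"] by blast
  define s where "s = norm (A *v v)"
  have nv: "norm v = 1" using v by simp
  have low: "s * norm w \<le> norm (A *v w)" if w: "w \<in> ?S" for w
  proof (cases "w = 0")
    case False
    with w S have "(1 / norm w) *\<^sub>R w \<in> ?K"
      by (auto intro: subspace_scale)
    from vmin[OF this] False show ?thesis
      by (simp add: s_def matrix_vector_mult_scaleR field_simps)
  qed simp
  obtain y where y: "v = transpose A *v y" using v by auto
  have "s > 0"
  proof (rule ccontr)
    assume "\<not> s > 0"
    then have "A *v v = 0" by (simp add: s_def)
    then have "v \<bullet> v = 0" using inner_transpose_matrix[of A y v] y by simp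
    with nv show False by simp
  qed
  define g where "g = transpose A *v (A *v v) - s\<^sup>2 *\<^sub>R v"
  define q where "q w = (norm (A *v w))\<^sup>2 - s\<^sup>2 * (norm w)\<^sup>2" for w
  have q_nonneg: "0 \<le> q w" if "w \<in> ?S" for w
    using power_mono[OF low[OF that], of 2] \<open>s > 0\<close> by (simp add: q_def power_mult_distrib)
  have gS: "g \<in> ?S"
    unfolding g_def using v S by (intro subspace_diff subspace_scale) auto
  have "g \<bullet> g = 0"
  proof (rule nonneg_quadratic_linear_term_zero)
    fix t :: real
    have "v + t *\<^sub>R g \<in> ?S"
      using v gS S by (intro subspace_add subspace_scale) auto
    then have "0 \<le> q (v + t *\<^sub>R g)" by (rule q_nonneg)
    also have "\<dots> = q v + 2 * t * ((A *v v) \<bullet> (A *v g) - s\<^sup>2 * (v \<bullet> g)) + t\<^sup>2 * q g"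
      unfolding q_def matrix_vector_right_distrib matrix_vector_mult_scaleR power2_norm_eq_inner
      by (simp add: inner_add_left inner_add_right inner_commute algebra_simps power2_eq_square)
    also have "q v = 0" by (simp add: q_def s_def nv)
    also have "(A *v v) \<bullet> (A *v g) - s\<^sup>2 * (v \<bullet> g) = g \<bullet> g"
      by (simp add: inner_transpose_matrix[symmetric] g_def inner_diff_left)
    finally show "0 \<le> 2 * t * (g \<bullet> g) + t\<^sup>2 * q g" by simp
  qed (rule q_nonneg[OF gS])
  then have eig: "(transpose A ** A) *v v = s\<^sup>2 *\<^sub>R v"
    by (simp add: g_def matrix_vector_mul_assoc)
  show thesis
    by (rule that[OF \<open>s > 0\<close> nv s_def[symmetric] eig low])
qed

text \<open>A singular vector \<open>w\<close> for a positive singular value \<open>t\<close> is \<open>A\<^sup>T (A w) / t\<^sup>2\<close>, thus in the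
  range of \<open>A\<^sup>T\<close>, where the lower bound applies and yields \<open>s \<le> t\<close>. So the least positive
  singular value exists and equals \<open>s\<close>.\<close>

lemma sigma_min_eqI:
  fixes A :: "real^'d^'m"
  assumes "A \<noteq> 0" "s > 0" "v \<noteq> 0" "(transpose A ** A) *v v = s\<^sup>2 *\<^sub>R v"
    and low: "\<And>w. w \<in> range ((*v) (transpose A)) \<Longrightarrow> s * norm w \<le> norm (A *v w)"
  shows "sigma_min A = s"
proof -
  have "(LEAST s. s > 0 \<and> singular_value A s) = s"
  proof (rule Least_equality)
    show "s > 0 \<and> singular_value A s"
      using assms by (auto simp: singular_value_def)
  next
    fix t assume "t > 0 \<and> singular_value A t"
    then obtain w where t: "t > 0" and w: "w \<noteq> 0" "(transpose A ** A) *v w = t\<^sup>2 *\<^sub>R w"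
      by (auto simp: singular_value_def)
    have "w = (1 / t\<^sup>2) *\<^sub>R ((transpose A ** A) *v w)"
      using t w by simp
    also have "\<dots> = transpose A *v ((1 / t\<^sup>2) *\<^sub>R (A *v w))"
      by (simp add: matrix_vector_mult_scaleR matrix_vector_mul_assoc)
    finally have "s * norm w \<le> norm (A *v w)"
      by (intro low) (rule range_eqI)
    moreover have "(norm (A *v w))\<^sup>2 = (t * norm w)\<^sup>2"
    proof -
      have "(norm (A *v w))\<^sup>2 = ((transpose A ** A) *v w) \<bullet> w"
        by (simp add: power2_norm_eq_inner inner_transpose_matrix flip: matrix_vector_mul_assoc)
      then show ?thesis
        by (simp add: w power_mult_distrib power2_norm_eq_inner)
    qed
    then have "norm (A *v w) = t * norm w"
      using t by (simp add: power2_eq_iff_nonneg)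
    ultimately show "s \<le> t" using w by simp
  qed
  with assms show ?thesis by (simp add: sigma_min_def)
qed

lemma sigma_min_nonneg: "0 \<le> sigma_min A"
  and sigma_min_le_opnorm: "sigma_min A \<le> opnorm A"
  and sigma_min_lower_bound:
    "w \<in> range ((*v) (transpose A)) \<Longrightarrow> sigma_min A * norm w \<le> norm (A *v w)"
  for A :: "real^'d^'m"
proof -
  have "0 \<le> sigma_min A \<and> sigma_min A \<le> opnorm A \<and>
    (\<forall>w \<in> range ((*v) (transpose A)). sigma_min A * norm w \<le> norm (A *v w))"
  proof (cases "A = 0")
    case True
    then show ?thesis
      by (simp add: sigma_min_def opnorm_zero)
  next
    case False
    from least_stretch_on_range_transpose[OF this] obtain v s where
      s: "s > 0" "norm v = 1" "norm (A *v v) = s" "(transpose A ** A) *v v = s\<^sup>2 *\<^sub>R v"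
      "\<And>w. w \<in> range ((*v) (transpose A)) \<Longrightarrow> s * norm w \<le> norm (A *v w)"
      by metis
    then have "sigma_min A = s"
      using False by (intro sigma_min_eqI) auto
    with s norm_matrix_le_opnorm[of A v] show ?thesis by auto
  qed
  then show "0 \<le> sigma_min A" "sigma_min A \<le> opnorm A"
    "w \<in> range ((*v) (transpose A)) \<Longrightarrow> sigma_min A * norm w \<le> norm (A *v w)"
    by auto
qed

text \<open>The bound passes from \<open>A\<close> to \<open>A\<^sup>T\<close> by duality: if \<open>r = A u\<close> with \<open>u\<close> in the range of \<open>A\<^sup>T\<close>,
  then \<open>\<parallel>r\<parallel>\<^sup>2 = \<langle>A\<^sup>T r, u\<rangle> \<le> \<parallel>A\<^sup>T r\<parallel> \<parallel>u\<parallel>\<close> and \<open>\<sigma>\<^sub>m\<^sub>i\<^sub>n \<parallel>u\<parallel> \<le> \<parallel>r\<parallel>\<close>.\<close>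

lemma sigma_min_transpose_lower_bound:
  fixes A :: "real^'d^'m"
  assumes "r \<in> range ((*v) A)"
  shows "sigma_min A * norm r \<le> norm (transpose A *v r)"
proof (cases "r = 0")
  case False
  obtain u where u: "u \<in> range ((*v) (transpose A))" "r = A *v u"
    using assms preimage_in_range_transpose[of A] by (metis imageE)
  have "norm r * (sigma_min A * norm r) = sigma_min A * (r \<bullet> (A *v u))"
    using u by (simp add: dot_square_norm power2_eq_square)
  also have "\<dots> = sigma_min A * ((transpose A *v r) \<bullet> u)"
    by (simp add: inner_transpose_matrix)
  also have "\<dots> \<le> sigma_min A * (norm (transpose A *v r) * norm u)"
    by (intro mult_left_mono norm_cauchy_schwarz sigma_min_nonneg)
  also have "\<dots> = (sigma_min A * norm u) * norm (transpose A *v r)"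
    by simp
  also have "\<dots> \<le> norm r * norm (transpose A *v r)"
    using sigma_min_lower_bound[OF u(1)] u(2) by (intro mult_right_mono) auto
  finally show ?thesis using False by simp
qed simp

section \<open>Moments of isotropic directions\<close>

text \<open>The quadratic form of a fixed vector is a bounded linear functional of the matrix, so it
  commutes with the two matrix-valued expectations in the isotropy assumption.\<close>

lemma inner_outer_mult:
  fixes g x :: "real^'d"
  shows "g \<bullet> (outer x x *v g) = (g \<bullet> x)\<^sup>2"
  unfolding power2_eq_square inner_vec_def outer_def matrix_vector_mult_def
  by (simp add: sum_product sum_distrib_left mult_ac)

lemma bounded_linear_quadratic_form:
  fixes g :: "real^'d"
  shows "bounded_linear (\<lambda>B::real^'d^'d. g \<bullet> (B *v g))"
  by (intro linear_conv_bounded_linear[THEN iffD1] linearI)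
     (simp_all add: matrix_vector_mult_add_rdistrib inner_add_right scaleR_matrix_vector_assoc[symmetric])

lemma isotropic_second_moment:
  fixes g :: "real^'d"
  assumes "isotropic M x c"
  shows "has_bochner_integral M (\<lambda>\<omega>. (g \<bullet> x \<omega>)\<^sup>2) ((norm g)\<^sup>2)"
  using has_bochner_integral_bounded_linear[OF bounded_linear_quadratic_form[of g]
      conjunct1[OF assms[unfolded isotropic_def]]]
  by (simp add: inner_outer_mult power2_norm_eq_inner)

lemma isotropic_fourth_moment:
  fixes g :: "real^'d"
  assumes "isotropic M x c"
  shows "has_bochner_integral M (\<lambda>\<omega>. (norm (x \<omega>))\<^sup>2 * (g \<bullet> x \<omega>)\<^sup>2) (c * (norm g)\<^sup>2)"
  using has_bochner_integral_bounded_linear[OF bounded_linear_quadratic_form[of g]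
      conjunct2[OF assms[unfolded isotropic_def]]]
  by (simp add: inner_outer_mult power2_norm_eq_inner scaleR_matrix_vector_assoc[symmetric])

lemma norm_sq_eq_sum_axis:
  fixes x :: "real^'d"
  shows "(norm x)\<^sup>2 = (\<Sum>i\<in>UNIV. (axis i 1 \<bullet> x)\<^sup>2)"
  unfolding power2_norm_eq_inner inner_vec_def[of x x]
  by (simp add: inner_axis' power2_eq_square)

text \<open>Taking traces in the isotropy assumption gives mean \<open>d\<close> for \<open>\<parallel>x\<parallel>\<^sup>2\<close> and mean \<open>c d\<close> for
  \<open>\<parallel>x\<parallel>\<^sup>4\<close>. The variance \<open>c d - d\<^sup>2\<close> of \<open>\<parallel>x\<parallel>\<^sup>2\<close> is nonnegative.\<close>

lemma isotropic_constant_ge_dim: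
  fixes x :: "'a \<Rightarrow> real^'d"
  assumes "prob_space M" and iso: "isotropic M x c"
  shows "real CARD('d) \<le> c"
proof -
  interpret prob_space M by fact
  let ?d = "real CARD('d)"
  have m2: "has_bochner_integral M (\<lambda>\<omega>. (norm (x \<omega>))\<^sup>2) ?d"
  proof -
    have "has_bochner_integral M (\<lambda>\<omega>. \<Sum>i\<in>UNIV. (axis i 1 \<bullet> x \<omega>)\<^sup>2)
        (\<Sum>i\<in>(UNIV::'d set). (norm (axis i 1 :: real^'d))\<^sup>2)"
      by (intro has_bochner_integral_sum isotropic_second_moment[OF iso])
    then show ?thesis by (simp add: norm_sq_eq_sum_axis[symmetric])
  qed
  have m4: "has_bochner_integral M (\<lambda>\<omega>. (norm (x \<omega>))\<^sup>2 * (norm (x \<omega>))\<^sup>2) (?d * c)"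
  proof -
    have "has_bochner_integral M (\<lambda>\<omega>. \<Sum>i\<in>UNIV. (norm (x \<omega>))\<^sup>2 * (axis i 1 \<bullet> x \<omega>)\<^sup>2)
        (\<Sum>i\<in>(UNIV::'d set). c * (norm (axis i 1 :: real^'d))\<^sup>2)"
      by (intro has_bochner_integral_sum isotropic_fourth_moment[OF iso])
    then show ?thesis by (simp add: norm_sq_eq_sum_axis[symmetric] sum_distrib_left[symmetric])
  qed
  have "has_bochner_integral M
      (\<lambda>\<omega>. (norm (x \<omega>))\<^sup>2 * (norm (x \<omega>))\<^sup>2 - 2 * ?d * (norm (x \<omega>))\<^sup>2 + ?d\<^sup>2)
      (?d * c - 2 * ?d * ?d + ?d\<^sup>2)" (is "has_bochner_integral M ?f ?I")
    using has_bochner_integral_integrable[of M "\<lambda>_. ?d\<^sup>2"] prob_space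
    by (intro has_bochner_integral_add has_bochner_integral_diff m4 m2
        has_bochner_integral_mult_right) simp_all
  then have "?I = integral\<^sup>L M ?f"
    by (simp add: has_bochner_integral_iff)
  moreover have "?f = (\<lambda>\<omega>. ((norm (x \<omega>))\<^sup>2 - ?d)\<^sup>2)"
    by (simp add: fun_eq_iff power2_eq_square algebra_simps)
  ultimately have "0 \<le> ?I" by simp
  then have "?d * ?d \<le> ?d * c"
    by (simp add: power2_eq_square)
  then show ?thesis by simp
qed

section \<open>One step of the iteration\<close>

definition sgdas_step :: "real^'d^'m \<Rightarrow> real^'m \<Rightarrow> real \<Rightarrow> real^'d \<Rightarrow> real^'d \<Rightarrow> real^'d" where
  "sgdas_step A b \<tau> v x = v - (\<tau> * ((A *v v - b) \<bullet> (A *v x))) *\<^sub>R x"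

lemma sgdas_Suc: "sgdas A b (\<lambda>_. \<tau>) x (Suc k) = sgdas_step A b \<tau> (sgdas A b (\<lambda>_. \<tau>) x k) (x k)"
  by (simp add: sgdas_step_def)

lemma sgdas_cong:
  assumes "\<And>j. j < k \<Longrightarrow> x j = y j"
  shows "sgdas A b \<tau> x k = sgdas A b \<tau> y k"
  using assms by (induction k) auto

lemma residual_sgdas_step:
  fixes A :: "real^'d^'m" and x :: "real^'d"
  assumes "g = transpose A *v (A *v v - b)"
  shows "(norm (A *v sgdas_step A b \<tau> v x - b))\<^sup>2 =
    (norm (A *v v - b))\<^sup>2 - 2 * \<tau> * (g \<bullet> x)\<^sup>2 + \<tau>\<^sup>2 * ((norm (A *v x))\<^sup>2 * (g \<bullet> x)\<^sup>2)"
proof -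
  define r where "r = A *v v - b"
  have g: "g \<bullet> x = r \<bullet> (A *v x)"
    by (simp add: assms r_def inner_transpose_matrix)
  have "A *v sgdas_step A b \<tau> v x - b = r - (\<tau> * (g \<bullet> x)) *\<^sub>R (A *v x)"
    by (simp add: sgdas_step_def g r_def matrix_vector_mult_diff_distrib matrix_vector_mult_scaleR)
  then have "(norm (A *v sgdas_step A b \<tau> v x - b))\<^sup>2 =
      (norm r)\<^sup>2 - 2 * (\<tau> * (g \<bullet> x)) * (g \<bullet> x) + (\<tau> * (g \<bullet> x))\<^sup>2 * (norm (A *v x))\<^sup>2"
    unfolding power2_norm_eq_inner
    by (simp add: inner_diff_left inner_diff_right inner_commute g power2_eq_square)
  then show ?thesis by (simp add: r_def power2_eq_square mult_ac)
qed

lemma measurable_matrix_vector_mult[measurable (raw)]: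
  fixes A :: "real^'d^'m"
  assumes "f \<in> borel_measurable N"
  shows "(\<lambda>\<omega>. A *v f \<omega>) \<in> borel_measurable N"
  by (rule borel_measurable_continuous_on[OF _ assms])
     (intro linear_continuous_on matrix_vector_mul_bounded_linear)

text \<open>Isotropy evaluates the mean of \<open>\<parallel>x\<parallel>\<^sup>2 \<langle>g, x\<rangle>\<^sup>2\<close> only, so the factor \<open>\<parallel>A x\<parallel>\<^sup>2\<close> is first
  replaced by \<open>\<parallel>A\<parallel>\<^sup>2 \<parallel>x\<parallel>\<^sup>2\<close>; the same domination provides integrability. The upper bound on the
  step size makes the coefficient of \<open>\<parallel>g\<parallel>\<^sup>2\<close> nonpositive, which allows \<open>\<parallel>g\<parallel>\<close> to be replaced by
  its lower bound \<open>\<sigma>\<^sub>m\<^sub>i\<^sub>n \<parallel>r\<parallel>\<close>.\<close>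

lemma expected_residual_sgdas_step:
  fixes A :: "real^'d^'m" and X :: "'a \<Rightarrow> real^'d"
  assumes prob: "prob_space M" and [measurable]: "X \<in> borel_measurable M"
    and iso: "isotropic M X c"
    and r: "A *v v - b \<in> range ((*v) A)"
    and tau: "0 \<le> \<tau>" "\<tau> * c * (opnorm A)\<^sup>2 \<le> 2"
  shows "integrable M (\<lambda>\<omega>. (norm (A *v sgdas_step A b \<tau> v (X \<omega>) - b))\<^sup>2)"
    and "(\<integral>\<omega>. (norm (A *v sgdas_step A b \<tau> v (X \<omega>) - b))\<^sup>2 \<partial>M)
      \<le> (1 - \<tau> * (sigma_min A)\<^sup>2 * (2 - \<tau> * c * (opnorm A)\<^sup>2)) * (norm (A *v v - b))\<^sup>2"
proof -
  interpret prob_space M by fact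
  define g where "g = transpose A *v (A *v v - b)"
  let ?R = "(norm (A *v v - b))\<^sup>2"
  note m2 = isotropic_second_moment[OF iso, of g]
  note m4 = isotropic_fourth_moment[OF iso, of g]
  have bound: "(norm (A *v X \<omega>))\<^sup>2 * (g \<bullet> X \<omega>)\<^sup>2
      \<le> (opnorm A)\<^sup>2 * ((norm (X \<omega>))\<^sup>2 * (g \<bullet> X \<omega>)\<^sup>2)" for \<omega>
    using mult_right_mono[OF power_mono[OF norm_matrix_le_opnorm[of A "X \<omega>"], of 2],
        of "(g \<bullet> X \<omega>)\<^sup>2"]
    by (simp add: power_mult_distrib mult_ac)
  have int4: "integrable M (\<lambda>\<omega>. (opnorm A)\<^sup>2 * ((norm (X \<omega>))\<^sup>2 * (g \<bullet> X \<omega>)\<^sup>2))"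
    using m4 by (auto simp: has_bochner_integral_iff)
  have intA: "integrable M (\<lambda>\<omega>. (norm (A *v X \<omega>))\<^sup>2 * (g \<bullet> X \<omega>)\<^sup>2)"
    by (rule Bochner_Integration.integrable_bound[OF int4])
       (use bound in \<open>auto simp: abs_mult\<close>)
  have "(\<integral>\<omega>. (norm (A *v X \<omega>))\<^sup>2 * (g \<bullet> X \<omega>)\<^sup>2 \<partial>M)
      \<le> (\<integral>\<omega>. (opnorm A)\<^sup>2 * ((norm (X \<omega>))\<^sup>2 * (g \<bullet> X \<omega>)\<^sup>2) \<partial>M)"
    by (intro integral_mono intA int4 bound)
  also have "\<dots> = (opnorm A)\<^sup>2 * (c * (norm g)\<^sup>2)"
    using m4 by (simp add: has_bochner_integral_iff)
  finally have le4: "(\<integral>\<omega>. (norm (A *v X \<omega>))\<^sup>2 * (g \<bullet> X \<omega>)\<^sup>2 \<partial>M) \<le> (opnorm A)\<^sup>2 * (c * (norm g)\<^sup>2)" .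
  have hbi: "has_bochner_integral M (\<lambda>\<omega>. (norm (A *v sgdas_step A b \<tau> v (X \<omega>) - b))\<^sup>2)
      (?R - 2 * \<tau> * (norm g)\<^sup>2 + \<tau>\<^sup>2 * (\<integral>\<omega>. (norm (A *v X \<omega>))\<^sup>2 * (g \<bullet> X \<omega>)\<^sup>2 \<partial>M))"
    unfolding residual_sgdas_step[OF g_def]
    using has_bochner_integral_integrable[of M "\<lambda>_. ?R"] prob_space
    by (intro has_bochner_integral_add has_bochner_integral_diff m2
        has_bochner_integral_mult_right has_bochner_integral_integrable[OF intA]) simp_all
  then show "integrable M (\<lambda>\<omega>. (norm (A *v sgdas_step A b \<tau> v (X \<omega>) - b))\<^sup>2)"
    by (auto simp: has_bochner_integral_iff)
  have "(\<integral>\<omega>. (norm (A *v sgdas_step A b \<tau> v (X \<omega>) - b))\<^sup>2 \<partial>M) =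
      ?R - 2 * \<tau> * (norm g)\<^sup>2 + \<tau>\<^sup>2 * (\<integral>\<omega>. (norm (A *v X \<omega>))\<^sup>2 * (g \<bullet> X \<omega>)\<^sup>2 \<partial>M)"
    using hbi by (simp add: has_bochner_integral_iff)
  also have "\<dots> \<le> ?R - 2 * \<tau> * (norm g)\<^sup>2 + \<tau>\<^sup>2 * ((opnorm A)\<^sup>2 * (c * (norm g)\<^sup>2))"
    by (intro add_left_mono mult_left_mono le4) simp
  also have "\<dots> = ?R - \<tau> * (2 - \<tau> * c * (opnorm A)\<^sup>2) * (norm g)\<^sup>2"
    by (simp add: algebra_simps power2_eq_square)
  also have "\<dots> \<le> ?R - \<tau> * (2 - \<tau> * c * (opnorm A)\<^sup>2) * ((sigma_min A)\<^sup>2 * ?R)"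
  proof -
    have "(sigma_min A)\<^sup>2 * ?R \<le> (norm g)\<^sup>2"
      unfolding g_def power_mult_distrib[symmetric]
      by (intro power_mono sigma_min_transpose_lower_bound r mult_nonneg_nonneg sigma_min_nonneg) simp
    then show ?thesis
      using tau by (intro diff_left_mono mult_left_mono) auto
  qed
  also have "\<dots> = (1 - \<tau> * (sigma_min A)\<^sup>2 * (2 - \<tau> * c * (opnorm A)\<^sup>2)) * ?R"
    by (simp add: algebra_simps)
  finally show "(\<integral>\<omega>. (norm (A *v sgdas_step A b \<tau> v (X \<omega>) - b))\<^sup>2 \<partial>M)
      \<le> (1 - \<tau> * (sigma_min A)\<^sup>2 * (2 - \<tau> * c * (opnorm A)\<^sup>2)) * ?R" .
qed

text \<open>Replacing \<open>\<sigma>\<close> by \<open>n\<close> decreases the right-hand side to \<open>1 - 2 t + c t\<^sup>2\<close> with \<open>t = \<tau> n\<^sup>2\<close>, and the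
  left-hand side is this value with the square completed.\<close>

lemma contraction_factor_lower_bound:
  fixes \<sigma> n c \<tau> :: real
  assumes "0 \<le> \<sigma>" "\<sigma> \<le> n" "1 \<le> c" "0 \<le> \<tau>" "\<tau> * c * n\<^sup>2 \<le> 2"
  shows "(1 - \<tau> * n\<^sup>2)\<^sup>2 + (c - 1) * (\<tau> * n\<^sup>2)\<^sup>2 \<le> 1 - \<tau> * \<sigma>\<^sup>2 * (2 - \<tau> * c * n\<^sup>2)"
proof -
  have "\<tau> * \<sigma>\<^sup>2 * (2 - \<tau> * c * n\<^sup>2) \<le> \<tau> * n\<^sup>2 * (2 - \<tau> * c * n\<^sup>2)"
    using assms by (intro mult_right_mono mult_left_mono power_mono) auto
  then show ?thesis by (simp add: power2_eq_square algebra_simps)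
qed

section \<open>Averaging over the past\<close>

text \<open>The induction over the steps is carried out with nonnegative integrals, so that integrability
  of the squared residual comes out of it, as a consequence of the finite bound.\<close>

lemma nn_integral_indep_fubini:
  assumes prob: "prob_space M" and indep: "prob_space.indep_var M borel V borel X"
    and f: "f \<in> borel_measurable (borel \<Otimes>\<^sub>M borel)"
  shows "(\<integral>\<^sup>+\<omega>. f (V \<omega>, X \<omega>) \<partial>M) = (\<integral>\<^sup>+\<omega>. (\<integral>\<^sup>+\<omega>'. f (V \<omega>, X \<omega>') \<partial>M) \<partial>M)"
proof -
  interpret prob_space M by fact
  note f[measurable]
  have [measurable]: "V \<in> borel_measurable M" "X \<in> borel_measurable M"
    using indep_var_rv1[OF indep] indep_var_rv2[OF indep] by auto
  interpret D: prob_space "distr M borel X" by (rule prob_space_distr) simp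
  have "(\<integral>\<^sup>+\<omega>. f (V \<omega>, X \<omega>) \<partial>M) =
      (\<integral>\<^sup>+z. f z \<partial>distr M (borel \<Otimes>\<^sub>M borel) (\<lambda>\<omega>. (V \<omega>, X \<omega>)))"
    by (subst nn_integral_distr) auto
  also have "distr M (borel \<Otimes>\<^sub>M borel) (\<lambda>\<omega>. (V \<omega>, X \<omega>)) = distr M borel V \<Otimes>\<^sub>M distr M borel X"
    using indep indep_var_distribution_eq by metis
  also have "(\<integral>\<^sup>+z. f z \<partial>(distr M borel V \<Otimes>\<^sub>M distr M borel X)) =
      (\<integral>\<^sup>+v. (\<integral>\<^sup>+x. f (v, x) \<partial>distr M borel X) \<partial>distr M borel V)"
    by (rule D.nn_integral_fst[symmetric]) simp
  also have "\<dots> = (\<integral>\<^sup>+\<omega>. (\<integral>\<^sup>+\<omega>'. f (V \<omega>, X \<omega>') \<partial>M) \<partial>M)"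
    by (subst nn_integral_distr; (subst nn_integral_distr)?) auto
  finally show ?thesis .
qed

lemma measurable_sgdas:
  fixes A :: "real^'d^'m"
  assumes "\<And>j. j < k \<Longrightarrow> (\<lambda>\<omega>. x \<omega> j) \<in> borel_measurable N"
  shows "(\<lambda>\<omega>. sgdas A b \<tau> (x \<omega>) k) \<in> borel_measurable N"
  using assms
proof (induction k)
  case (Suc k)
  then have [measurable]: "(\<lambda>\<omega>. sgdas A b \<tau> (x \<omega>) k) \<in> borel_measurable N"
      "(\<lambda>\<omega>. x \<omega> k) \<in> borel_measurable N"
    by auto
  show ?case by simp
qed simp

text \<open>The \<open>k\<close>-th iterate is a measurable function of the directions with index below \<open>k\<close>, a block
  disjoint from \<open>{k}\<close>.\<close>

lemma indep_var_sgdas: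
  fixes A :: "real^'d^'m"
  assumes prob: "prob_space M" and fresh: "prob_space.indep_vars M (\<lambda>_. borel) X UNIV"
  shows "prob_space.indep_var M borel (\<lambda>\<omega>. sgdas A b \<tau> (\<lambda>j. X j \<omega>) k) borel (X k)"
proof -
  interpret prob_space M by fact
  have "indep_var (PiM {..<k} (\<lambda>_. borel)) (\<lambda>\<omega>. restrict (\<lambda>i. X i \<omega>) {..<k})
      (PiM {k} (\<lambda>_. borel)) (\<lambda>\<omega>. restrict (\<lambda>i. X i \<omega>) {k})"
    by (rule indep_var_restrict[OF fresh]) auto
  then have "indep_var borel ((\<lambda>y. sgdas A b \<tau> y k) \<circ> (\<lambda>\<omega>. restrict (\<lambda>i. X i \<omega>) {..<k}))
      borel ((\<lambda>y. y k) \<circ> (\<lambda>\<omega>. restrict (\<lambda>i. X i \<omega>) {k}))"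
    by (rule indep_var_compose) (auto intro!: measurable_sgdas)
  moreover have "sgdas A b \<tau> (restrict (\<lambda>i. X i \<omega>) {..<k}) k = sgdas A b \<tau> (\<lambda>j. X j \<omega>) k" for \<omega>
    by (rule sgdas_cong) simp
  ultimately show ?thesis by (simp add: comp_def)
qed

section \<open>Linear convergence\<close>

theorem theorem3p9:
  fixes A :: "real^'d^'m" and b :: "real^'m"
    and M :: "'a measure" and X :: "nat \<Rightarrow> 'a \<Rightarrow> real^'d"
    and c \<tau> \<beta> :: real
  assumes consistent: "\<exists>u. A *v u = b"
    and prob: "prob_space M"
    and fresh: "prob_space.indep_vars M (\<lambda>_. borel) X UNIV"
    and iso: "\<And>k. isotropic M (X k) c"
    and tau_pos: "0 < \<tau>"
    and tau_less: "A = 0 \<or> \<tau> < 2 / (c * (opnorm A)\<^sup>2)"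
    and beta: "\<beta> = 1 - \<tau> * (sigma_min A)\<^sup>2 * (2 - \<tau> * c * (opnorm A)\<^sup>2)"
  shows
    "(\<forall>k x.
        integrable M (\<lambda>\<omega>. (norm (A *v sgdas A b (\<lambda>_. \<tau>) (x(k := X k \<omega>)) (Suc k) - b))\<^sup>2) \<and>
        (\<integral>\<omega>. (norm (A *v sgdas A b (\<lambda>_. \<tau>) (x(k := X k \<omega>)) (Suc k) - b))\<^sup>2 \<partial>M)
          \<le> \<beta> * (norm (A *v sgdas A b (\<lambda>_. \<tau>) x k - b))\<^sup>2)
     \<and>
     (sigma_min A > 0 \<longrightarrow>
        (0 \<le> \<beta> \<and> \<beta> < 1 \<and>
         (\<not> (CARD('d) = 1 \<and> c = 1 \<and> \<tau> * (opnorm A)\<^sup>2 = 1) \<longrightarrow> 0 < \<beta>)) \<and>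
        (\<forall>k.
          integrable M (\<lambda>\<omega>. (norm (A *v sgdas A b (\<lambda>_. \<tau>) (\<lambda>j. X j \<omega>) (Suc k) - b))\<^sup>2) \<and>
          (\<integral>\<omega>. (norm (A *v sgdas A b (\<lambda>_. \<tau>) (\<lambda>j. X j \<omega>) (Suc k) - b))\<^sup>2 \<partial>M)
            \<le> \<beta> ^ (k + 1) * (norm (A *v 0 - b))\<^sup>2))"
proof -
  interpret prob_space M by (rule prob)
  have [measurable]: "X k \<in> borel_measurable M" for k
    using fresh by (auto simp: indep_vars_def)
  have c_dim: "real CARD('d) \<le> c"
    by (rule isotropic_constant_ge_dim[OF prob iso])
  have c1: "1 \<le> c"
    using c_dim zero_less_card_finite[where 'a='d] by linarith
  have strict: "\<tau> * c * (opnorm A)\<^sup>2 < 2"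
  proof (cases "A = 0")
    case True
    then show ?thesis by (simp add: opnorm_zero)
  next
    case False
    then have "opnorm A \<noteq> 0"
      by (metis matrix_vector_mul_bounded_linear onorm_eq_0 matrix_eq matrix_vector_mult_0)
    then have "0 < c * (opnorm A)\<^sup>2" using c1 by simp
    then show ?thesis
      using tau_less False by (simp add: pos_less_divide_eq mult_ac)
  qed
  have residual: "A *v v - b \<in> range ((*v) A)" for v
    using consistent by (metis matrix_vector_mult_diff_distrib rangeI)
  have step:
    "integrable M (\<lambda>\<omega>. (norm (A *v sgdas_step A b \<tau> v (X k \<omega>) - b))\<^sup>2)"
    "(\<integral>\<omega>. (norm (A *v sgdas_step A b \<tau> v (X k \<omega>) - b))\<^sup>2 \<partial>M) \<le> \<beta> * (norm (A *v v - b))\<^sup>2"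
    for v k
    using expected_residual_sgdas_step[OF prob _ iso residual, where \<tau>=\<tau>] tau_pos strict
    by (auto simp: beta)
  have one_step: "sgdas A b (\<lambda>_. \<tau>) (x(k := y)) (Suc k)
      = sgdas_step A b \<tau> (sgdas A b (\<lambda>_. \<tau>) x k) y" for x k y
    unfolding sgdas_Suc using sgdas_cong[of k "x(k := y)" x A b "\<lambda>_. \<tau>"] by simp
  have beta_lower: "(1 - \<tau> * (opnorm A)\<^sup>2)\<^sup>2 + (c - 1) * (\<tau> * (opnorm A)\<^sup>2)\<^sup>2 \<le> \<beta>"
    unfolding beta using c1 tau_pos strict
    by (intro contraction_factor_lower_bound sigma_min_nonneg sigma_min_le_opnorm) auto
  have beta_nonneg: "0 \<le> \<beta>"
    by (rule order_trans[OF _ beta_lower]) (use c1 in simp)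
  have beta_less: "\<beta> < 1" if "sigma_min A > 0"
    using that tau_pos strict by (simp add: beta)
  have beta_pos: "0 < \<beta>" if ne: "\<not> (CARD('d) = 1 \<and> c = 1 \<and> \<tau> * (opnorm A)\<^sup>2 = 1)"
  proof (cases "\<tau> * (opnorm A)\<^sup>2 = 1")
    case True
    have "c \<noteq> 1"
    proof
      assume "c = 1"
      with c_dim have "CARD('d) = 1"
        using zero_less_card_finite[where 'a='d] by linarith
      with ne True \<open>c = 1\<close> show False by simp
    qed
    with c1 beta_lower True show ?thesis by simp
  next
    case False
    then have "0 < (1 - \<tau> * (opnorm A)\<^sup>2)\<^sup>2" by simp
    moreover have "0 \<le> (c - 1) * (\<tau> * (opnorm A)\<^sup>2)\<^sup>2" using c1 by simp
    ultimately show ?thesis using beta_lower by linarith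
  qed
  let ?V = "\<lambda>k \<omega>. sgdas A b (\<lambda>_. \<tau>) (\<lambda>j. X j \<omega>) k"
  have [measurable]: "?V k \<in> borel_measurable M" for k
    by (rule measurable_sgdas) simp
  have nn: "(\<integral>\<^sup>+\<omega>. ennreal ((norm (A *v ?V k \<omega> - b))\<^sup>2) \<partial>M)
      \<le> ennreal (\<beta> ^ k * (norm (A *v 0 - b))\<^sup>2)" for k
  proof (induction k)
    case 0
    then show ?case by (simp add: emeasure_space_1)
  next
    case (Suc k)
    define f where "f = (\<lambda>(v, x). ennreal ((norm (A *v sgdas_step A b \<tau> v x - b))\<^sup>2))"
    have f[measurable]: "f \<in> borel_measurable (borel \<Otimes>\<^sub>M borel)"
      unfolding f_def sgdas_step_def case_prod_beta by measurable
    have "(\<integral>\<^sup>+\<omega>. ennreal ((norm (A *v ?V (Suc k) \<omega> - b))\<^sup>2) \<partial>M) = (\<integral>\<^sup>+\<omega>. f (?V k \<omega>, X k \<omega>) \<partial>M)"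
      by (simp add: f_def sgdas_step_def)
    also have "\<dots> = (\<integral>\<^sup>+\<omega>. (\<integral>\<^sup>+\<omega>'. f (?V k \<omega>, X k \<omega>') \<partial>M) \<partial>M)"
      by (rule nn_integral_indep_fubini[OF prob indep_var_sgdas[OF prob fresh] f])
    also have "\<dots> \<le> (\<integral>\<^sup>+\<omega>. ennreal \<beta> * ennreal ((norm (A *v ?V k \<omega> - b))\<^sup>2) \<partial>M)"
    proof (rule nn_integral_mono)
      fix \<omega>
      have "(\<integral>\<^sup>+\<omega>'. f (?V k \<omega>, X k \<omega>') \<partial>M) =
          ennreal (\<integral>\<omega>'. (norm (A *v sgdas_step A b \<tau> (?V k \<omega>) (X k \<omega>') - b))\<^sup>2 \<partial>M)"
        unfolding f_def prod.case by (intro nn_integral_eq_integral step) simp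
      also have "\<dots> \<le> ennreal (\<beta> * (norm (A *v ?V k \<omega> - b))\<^sup>2)"
        by (intro ennreal_leI step)
      finally show "(\<integral>\<^sup>+\<omega>'. f (?V k \<omega>, X k \<omega>') \<partial>M)
          \<le> ennreal \<beta> * ennreal ((norm (A *v ?V k \<omega> - b))\<^sup>2)"
        using beta_nonneg by (simp add: ennreal_mult)
    qed
    also have "\<dots> = ennreal \<beta> * (\<integral>\<^sup>+\<omega>. ennreal ((norm (A *v ?V k \<omega> - b))\<^sup>2) \<partial>M)"
      by (rule nn_integral_cmult) measurable
    also have "\<dots> \<le> ennreal \<beta> * ennreal (\<beta> ^ k * (norm (A *v 0 - b))\<^sup>2)"
      by (intro mult_left_mono Suc) simp
    also have "\<dots> = ennreal (\<beta> ^ Suc k * (norm (A *v 0 - b))\<^sup>2)"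
      using beta_nonneg by (simp add: ennreal_mult[symmetric] mult_ac)
    finally show ?case .
  qed
  have total: "integrable M (\<lambda>\<omega>. (norm (A *v ?V k \<omega> - b))\<^sup>2) \<and>
      (\<integral>\<omega>. (norm (A *v ?V k \<omega> - b))\<^sup>2 \<partial>M) \<le> \<beta> ^ k * (norm (A *v 0 - b))\<^sup>2" for k
  proof
    show int: "integrable M (\<lambda>\<omega>. (norm (A *v ?V k \<omega> - b))\<^sup>2)"
      using nn[of k] by (intro integrableI_nonneg) (auto simp: le_less_trans)
    show "(\<integral>\<omega>. (norm (A *v ?V k \<omega> - b))\<^sup>2 \<partial>M) \<le> \<beta> ^ k * (norm (A *v 0 - b))\<^sup>2"
      using nn[of k] beta_nonneg by (subst (asm) nn_integral_eq_integral[OF int]) auto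
  qed
  show ?thesis
    unfolding one_step using step beta_nonneg beta_less beta_pos total[of "Suc _"] by simp
qed

end
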